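(* Let $c$ be a GCL command, $f$ a label and $pc$ a variable such that $\mathrm{okf}(c,f)$, $pc$ does not occur in $c$, and $\mathrm{N}(c,f,gcs)$ (for $pc$). Let $n=\mathrm{lab}(c)$. Then $!n;\mathsf{do}\,gcs\,\mathsf{od}\ \simeq\ \mathrm{add}^{pc}(c);!f$.
   Context: GCL commands: $c::=\mathsf{skip}^n\mid x:=^n e\mid\mathsf{havoc}^n x\mid c;c\mid\mathsf{if}^n gcs\,\mathsf{fi}\mid\mathsf{do}^n gcs\,\mathsf{od}$, labels $n\in\mathbb{Z}$, $gcs$ a nonempty list of guarded commands $e\to c$ joined by $[\!]$, boolean guards built from primitive boolean expressions $bprim$ by $\wedge,\vee,\neg$, $\mathrm{enab}(gcs)$ the disjunction of the guards; variables integer-valued; commands are well typed and every $\mathsf{if}\,gcs\,\mathsf{fi}$ has $\mathrm{enab}(gcs)$ valid. $\mathrm{labs}(c)$ is the set of labels of $c$; $\mathrm{lab}(c)$ is its label with $\mathrm{lab}(c;d)=\mathrm{lab}(c)$; $\mathrm{okf}(c,f)$ means all labels of $c$ are positive and pairwise distinct and $f\notin\mathrm{labs}(c)$. $!n$ abbreviates the assignment $pc:=^0 n$ and $?n$ the boolean expression $pc=n$. $\mathrm{add}^{pc}$: $\mathrm{add}^{pc}(\mathsf{skip}^n)=!n;\mathsf{skip}^n$; $\mathrm{add}^{pc}(x:=^n e)=!n;x:=^n e$; $\mathrm{add}^{pc}(\mathsf{havoc}^n x)=!n;\mathsf{havoc}^n x$; $\mathrm{add}^{pc}(c;d)=\mathrm{add}^{pc}(c);\mathrm{add}^{pc}(d)$;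 $\mathrm{add}^{pc}(\mathsf{if}^n gcs\,\mathsf{fi})=!n;\mathsf{if}^n$ ($gcs$ with each $e\to c$ replaced by $e\to\mathrm{add}^{pc}(c)$) $\mathsf{fi}$; $\mathrm{add}^{pc}(\mathsf{do}^n gcs\,\mathsf{od})=!n;\mathsf{do}^n$ ($gcs$ with each $e\to c$ replaced by $e\to\mathrm{add}^{pc}(c);!n$) $\mathsf{od}$. The relation $\mathrm{N}$ is the least relation closed under: $\mathrm{N}(\mathsf{skip}^n,f,(?n\to!f))$; $\mathrm{N}(x:=^n e,f,(?n\to x:=e;!f))$; $\mathrm{N}(\mathsf{havoc}^n x,f,(?n\to\mathsf{havoc}\,x;!f))$; $\mathrm{N}(c,\mathrm{lab}(d),gcs_0)\wedge\mathrm{N}(d,f,gcs_1)\Rightarrow\mathrm{N}(c;d,f,gcs_0[\!]gcs_1)$; if $\mathrm{N}(c_i,f,gcs_i)$ ($i=1..k$) then $\mathrm{N}(\mathsf{if}^n\,e_1\to c_1[\!]\cdots[\!]e_k\to c_k\,\mathsf{fi},f,?n\wedge e_1\to!\mathrm{lab}(c_1)[\!]\cdots[\!]?n\wedge e_k\to!\mathrm{lab}(c_k)[\!]gcs_1[\!]\cdots[\!]gcs_k)$; if $\mathrm{N}(c_i,n,gcs_i)$ ($i=1..k$) then $\mathrm{N}(\mathsf{do}^n\,e_1\to c_1[\!]\cdots[\!]e_k\to c_k\,\mathsf{od},f,?n\wedge e_1\to!\mathrm{lab}(c_1)[\!]\cdots[\!]?n\wedge e_k\to!\mathrm{lab}(c_k)[\!]?n\wedge\neg(e_1\vee\cdots\vee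 e_k)\to!f[\!]gcs_1[\!]\cdots[\!]gcs_k)$. Command equivalence $c\simeq d$ means $\mathrm{Hyp}\vdash\lfloor c\rfloor=\lfloor d\rfloor$, where: the KAT axioms are those of an idempotent semiring $(\mathbb{K},+,;,0,1)$ with a Boolean subalgebra of tests ($1$ true, $;$ conjunction, $+$ disjunction, $\neg$ complement) and $1+x;x^*=x^*$, $1+x^*;x=x^*$, $y+x;z\le z\Rightarrow x^*;y\le z$, $y+z;x\le z\Rightarrow y;x^*\le z$ ($x\le y$ iff $x+y=y$); KAT expressions $E::=\underline{bprim}\mid\underline{x:=e}\mid\underline{\mathsf{havoc}\,x}\mid E+E\mid E;E\mid E^*\mid\neg E\mid1\mid0$; translation $\lfloor bprim\rfloor=\underline{bprim}$, $\lfloor\neg e\rfloor=\neg\lfloor e\rfloor$, $\lfloor e\wedge e'\rfloor=\lfloor e\rfloor;\lfloor e'\rfloor$, $\lfloor e\vee e'\rfloor=\lfloor e\rfloor+\lfloor e'\rfloor$, $\lfloor\mathsf{skip}\rfloor=1$, $\lfloor x:=e\rfloor=\underline{x:=e}$, $\lfloor\mathsf{havoc}\,x\rfloor=\underline{\mathsf{havoc}\,x}$, $\lfloor c;d\rfloor=\lfloor c\rfloor;\lfloor d\rfloor$, $\lfloor\mathsf{if}\,gcs\,\mathsf{fi}\rfloor=\lfloor gcs\rfloor$, $\lfloor\mathsf{do}\,gcs\,\mathsf{od}\rfloor=\lfloor gcs\rfloor^*;\neg\lfloor\mathrm{enab}(gcs)\rfloor$, $\lfloor gcs\rfloor=\sum_{e\to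 c\in gcs}\lfloor e\rfloor;\lfloor c\rfloor$; $\mathrm{Hyp}$ is: (a) $\lfloor e\rfloor=0$ for every boolean $e$ with $e\Rightarrow\mathit{false}$ valid; (b) $\lfloor e_0\rfloor;\underline{x:=e};\neg\lfloor e_1\rfloor=0$ whenever $e_0\Rightarrow e_1[x:=e]$ is valid; (c) $\lfloor e_0\rfloor;\underline{\mathsf{havoc}\,x};\neg\lfloor e_1\rfloor=0$ whenever $e_0\Rightarrow\forall x.e_1$ is valid ($\forall x.e_1$ holds in $s$ iff $e_1$ holds in $s[x\mapsto v]$ for all $v$); $H\vdash E_0=E_1$ means provable by equational and propositional reasoning from $H$ and the KAT axioms. *)

theory Defs
  imports Main
begin

section \<open>Expressions\<close>

text \<open>The expression language is kept abstract: \<open>'f\<close> and \<open>'p\<close> are arbitrary types of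
  function and predicate symbols, interpreted by \<open>F\<close> and \<open>P\<close> below. Only variables,
  integer literals and equality (needed for \<open>pc = n\<close>) are built in.\<close>

type_synonym vname = string
type_synonym state = "vname \<Rightarrow> int"
type_synonym 'f fun_interp = "'f \<Rightarrow> int list \<Rightarrow> int"
type_synonym 'p pred_interp = "'p \<Rightarrow> int list \<Rightarrow> bool"

datatype 'f iexp = Lit int | Var vname | App 'f "'f iexp list"

datatype ('f, 'p) bprim = Eq "'f iexp" "'f iexp" | Rel 'p "'f iexp list"

datatype ('f, 'p) bexp =
    Prim "('f, 'p) bprim"
  | And "('f, 'p) bexp" "('f, 'p) bexp"
  | Or "('f, 'p) bexp" "('f, 'p) bexp"
  | Not "('f, 'p) bexp"

fun ival :: "'f fun_interp \<Rightarrow> 'f iexp \<Rightarrow> state \<Rightarrow> int" where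
  "ival F (Lit k) s = k"
| "ival F (Var x) s = s x"
| "ival F (App g es) s = F g (map (\<lambda>e. ival F e s) es)"

fun pval :: "'f fun_interp \<Rightarrow> 'p pred_interp \<Rightarrow> ('f, 'p) bprim \<Rightarrow> state \<Rightarrow> bool" where
  "pval F P (Eq e e') s = (ival F e s = ival F e' s)"
| "pval F P (Rel r es) s = P r (map (\<lambda>e. ival F e s) es)"

fun bval :: "'f fun_interp \<Rightarrow> 'p pred_interp \<Rightarrow> ('f, 'p) bexp \<Rightarrow> state \<Rightarrow> bool" where
  "bval F P (Prim p) s = pval F P p s"
| "bval F P (And e e') s = (bval F P e s \<and> bval F P e' s)"
| "bval F P (Or e e') s = (bval F P e s \<or> bval F P e' s)"
| "bval F P (Not e) s = (\<not> bval F P e s)"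

fun isubst :: "'f iexp \<Rightarrow> vname \<Rightarrow> 'f iexp \<Rightarrow> 'f iexp" where
  "isubst (Lit k) x a = Lit k"
| "isubst (Var y) x a = (if y = x then a else Var y)"
| "isubst (App g es) x a = App g (map (\<lambda>e. isubst e x a) es)"

fun psubst :: "('f, 'p) bprim \<Rightarrow> vname \<Rightarrow> 'f iexp \<Rightarrow> ('f, 'p) bprim" where
  "psubst (Eq e e') x a = Eq (isubst e x a) (isubst e' x a)"
| "psubst (Rel r es) x a = Rel r (map (\<lambda>e. isubst e x a) es)"

fun bsubst :: "('f, 'p) bexp \<Rightarrow> vname \<Rightarrow> 'f iexp \<Rightarrow> ('f, 'p) bexp" where
  "bsubst (Prim p) x a = Prim (psubst p x a)"
| "bsubst (And e e') x a = And (bsubst e x a) (bsubst e' x a)"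
| "bsubst (Or e e') x a = Or (bsubst e x a) (bsubst e' x a)"
| "bsubst (Not e) x a = Not (bsubst e x a)"

fun ivars :: "'f iexp \<Rightarrow> vname set" where
  "ivars (Lit k) = {}"
| "ivars (Var x) = {x}"
| "ivars (App g es) = (\<Union>e\<in>set es. ivars e)"

fun pvars :: "('f, 'p) bprim \<Rightarrow> vname set" where
  "pvars (Eq e e') = ivars e \<union> ivars e'"
| "pvars (Rel r es) = (\<Union>e\<in>set es. ivars e)"

fun bvars :: "('f, 'p) bexp \<Rightarrow> vname set" where
  "bvars (Prim p) = pvars p"
| "bvars (And e e') = bvars e \<union> bvars e'"
| "bvars (Or e e') = bvars e \<union> bvars e'"
| "bvars (Not e) = bvars e"


section \<open>Guarded commands\<close>

text \<open>Guarded command lists are plain lists here; \<open>wf_com\<close> imposes that they are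
  nonempty. Where a label is left unspecified informally, the label \<open>0\<close> is used.\<close>

datatype ('f, 'p) com =
    Skip int
  | Assign int vname "'f iexp"
  | Havoc int vname
  | Seq "('f, 'p) com" "('f, 'p) com"
  | If int "(('f, 'p) bexp \<times> ('f, 'p) com) list"
  | Do int "(('f, 'p) bexp \<times> ('f, 'p) com) list"

type_synonym ('f, 'p) gcs = "(('f, 'p) bexp \<times> ('f, 'p) com) list"

text \<open>The value of \<open>enab []\<close> is an unused default (a false expression).\<close>

fun enab :: "('f, 'p) gcs \<Rightarrow> ('f, 'p) bexp" where
  "enab [] = Not (Prim (Eq (Lit 0) (Lit 0)))"
| "enab [(e, c)] = e"
| "enab ((e, c) # gcs) = Or e (enab gcs)"

fun lab :: "('f, 'p) com \<Rightarrow> int" where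
  "lab (Skip n) = n"
| "lab (Assign n x e) = n"
| "lab (Havoc n x) = n"
| "lab (Seq c d) = lab c"
| "lab (If n gcs) = n"
| "lab (Do n gcs) = n"

fun lab_list :: "('f, 'p) com \<Rightarrow> int list" where
  "lab_list (Skip n) = [n]"
| "lab_list (Assign n x e) = [n]"
| "lab_list (Havoc n x) = [n]"
| "lab_list (Seq c d) = lab_list c @ lab_list d"
| "lab_list (If n gcs) = n # concat (map (\<lambda>(e, c). lab_list c) gcs)"
| "lab_list (Do n gcs) = n # concat (map (\<lambda>(e, c). lab_list c) gcs)"

definition labs :: "('f, 'p) com \<Rightarrow> int set" where
  "labs c = set (lab_list c)"

definition okf :: "('f, 'p) com \<Rightarrow> int \<Rightarrow> bool" where
  "okf c f \<longleftrightarrow> (\<forall>n\<in>labs c. 0 < n) \<and> distinct (lab_list c) \<and> f \<notin> labs c"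

fun cvars :: "('f, 'p) com \<Rightarrow> vname set" where
  "cvars (Skip n) = {}"
| "cvars (Assign n x e) = {x} \<union> ivars e"
| "cvars (Havoc n x) = {x}"
| "cvars (Seq c d) = cvars c \<union> cvars d"
| "cvars (If n gcs) = (\<Union>(e, c)\<in>set gcs. bvars e \<union> cvars c)"
| "cvars (Do n gcs) = (\<Union>(e, c)\<in>set gcs. bvars e \<union> cvars c)"

fun wf_com :: "'f fun_interp \<Rightarrow> 'p pred_interp \<Rightarrow> ('f, 'p) com \<Rightarrow> bool" where
  "wf_com F P (Skip n) = True"
| "wf_com F P (Assign n x e) = True"
| "wf_com F P (Havoc n x) = True"
| "wf_com F P (Seq c d) = (wf_com F P c \<and> wf_com F P d)"
| "wf_com F P (If n gcs) =
    (gcs \<noteq> [] \<and> (\<forall>s. bval F P (enab gcs) s) \<and> (\<forall>(e, c)\<in>set gcs. wf_com F P c))"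
| "wf_com F P (Do n gcs) = (gcs \<noteq> [] \<and> (\<forall>(e, c)\<in>set gcs. wf_com F P c))"


section \<open>Program counter instrumentation and normal form\<close>

abbreviation set_pc :: "vname \<Rightarrow> int \<Rightarrow> ('f, 'p) com" where
  "set_pc pc n \<equiv> Assign 0 pc (Lit n)"

abbreviation test_pc :: "vname \<Rightarrow> int \<Rightarrow> ('f, 'p) bexp" where
  "test_pc pc n \<equiv> Prim (Eq (Var pc) (Lit n))"

fun add_pc :: "vname \<Rightarrow> ('f, 'p) com \<Rightarrow> ('f, 'p) com" where
  "add_pc pc (Skip n) = Seq (set_pc pc n) (Skip n)"
| "add_pc pc (Assign n x e) = Seq (set_pc pc n) (Assign n x e)"
| "add_pc pc (Havoc n x) = Seq (set_pc pc n) (Havoc n x)"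
| "add_pc pc (Seq c d) = Seq (add_pc pc c) (add_pc pc d)"
| "add_pc pc (If n gcs) =
    Seq (set_pc pc n) (If n (map (\<lambda>(e, c). (e, add_pc pc c)) gcs))"
| "add_pc pc (Do n gcs) =
    Seq (set_pc pc n) (Do n (map (\<lambda>(e, c). (e, Seq (add_pc pc c) (set_pc pc n))) gcs))"

definition entries :: "vname \<Rightarrow> int \<Rightarrow> ('f, 'p) gcs \<Rightarrow> ('f, 'p) gcs" where
  "entries pc n gcs = map (\<lambda>(e, c). (And (test_pc pc n) e, set_pc pc (lab c))) gcs"

inductive N :: "vname \<Rightarrow> ('f, 'p) com \<Rightarrow> int \<Rightarrow> ('f, 'p) gcs \<Rightarrow> bool" for pc where
  N_Skip: "N pc (Skip n) f [(test_pc pc n, set_pc pc f)]"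
| N_Assign: "N pc (Assign n x e) f [(test_pc pc n, Seq (Assign 0 x e) (set_pc pc f))]"
| N_Havoc: "N pc (Havoc n x) f [(test_pc pc n, Seq (Havoc 0 x) (set_pc pc f))]"
| N_Seq: "N pc c (lab d) gcs0 \<Longrightarrow> N pc d f gcs1 \<Longrightarrow> N pc (Seq c d) f (gcs0 @ gcs1)"
| N_If: "list_all2 (\<lambda>gc g. N pc (snd gc) f g) gcs gss
    \<Longrightarrow> N pc (If n gcs) f (entries pc n gcs @ concat gss)"
| N_Do: "list_all2 (\<lambda>gc g. N pc (snd gc) n g) gcs gss
    \<Longrightarrow> N pc (Do n gcs) f
          (entries pc n gcs @ [(And (test_pc pc n) (Not (enab gcs)), set_pc pc f)] @ concat gss)"


section \<open>KAT expressions and provability\<close>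

datatype ('f, 'p) kat =
    KPrim "('f, 'p) bprim"
  | KAssign vname "'f iexp"
  | KHavoc vname
  | KPlus "('f, 'p) kat" "('f, 'p) kat" (infixl \<open>\<oplus>\<close> 65)
  | KSeq "('f, 'p) kat" "('f, 'p) kat" (infixl \<open>\<odot>\<close> 70)
  | KStar "('f, 'p) kat"
  | KNeg "('f, 'p) kat"
  | KOne
  | KZero

text \<open>Complement is an operation on tests only: in the calculus below, all rules
  about \<open>KNeg\<close> are restricted to test expressions.\<close>

fun is_test :: "('f, 'p) kat \<Rightarrow> bool" where
  "is_test (KPrim p) = True"
| "is_test (KAssign x e) = False"
| "is_test (KHavoc x) = False"
| "is_test (a \<oplus> b) = (is_test a \<and> is_test b)"
| "is_test (a \<odot> b) = (is_test a \<and> is_test b)"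
| "is_test (KStar a) = False"
| "is_test (KNeg a) = is_test a"
| "is_test KOne = True"
| "is_test KZero = True"

text \<open>Derivability from a set \<open>H\<close> of (closed) equations and the axioms of KAT. As all axioms
  are equations or Horn implications between equations, the calculus is equational logic
  together with the Horn axioms as inference rules; \<open>x \<le> y\<close> is spelled out as \<open>x + y = y\<close>.\<close>

inductive kat_prov ::
  "(('f, 'p) kat \<times> ('f, 'p) kat) set \<Rightarrow> ('f, 'p) kat \<Rightarrow> ('f, 'p) kat \<Rightarrow> bool"
  for H where
  hyp: "(x, y) \<in> H \<Longrightarrow> kat_prov H x y"
| refl: "kat_prov H x x"
| sym: "kat_prov H x y \<Longrightarrow> kat_prov H y x"
| trans: "kat_prov H x y \<Longrightarrow> kat_prov H y z \<Longrightarrow> kat_prov H x z"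
| cong_plus: "kat_prov H x x' \<Longrightarrow> kat_prov H y y' \<Longrightarrow> kat_prov H (x \<oplus> y) (x' \<oplus> y')"
| cong_seq: "kat_prov H x x' \<Longrightarrow> kat_prov H y y' \<Longrightarrow> kat_prov H (x \<odot> y) (x' \<odot> y')"
| cong_star: "kat_prov H x x' \<Longrightarrow> kat_prov H (KStar x) (KStar x')"
| cong_neg: "is_test a \<Longrightarrow> is_test b \<Longrightarrow> kat_prov H a b \<Longrightarrow> kat_prov H (KNeg a) (KNeg b)"
| plus_assoc: "kat_prov H (x \<oplus> y \<oplus> z) (x \<oplus> (y \<oplus> z))"
| plus_comm: "kat_prov H (x \<oplus> y) (y \<oplus> x)"
| plus_zero: "kat_prov H (x \<oplus> KZero) x"
| plus_idem: "kat_prov H (x \<oplus> x) x"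
| seq_assoc: "kat_prov H (x \<odot> y \<odot> z) (x \<odot> (y \<odot> z))"
| one_seq: "kat_prov H (KOne \<odot> x) x"
| seq_one: "kat_prov H (x \<odot> KOne) x"
| zero_seq: "kat_prov H (KZero \<odot> x) KZero"
| seq_zero: "kat_prov H (x \<odot> KZero) KZero"
| distl: "kat_prov H (x \<odot> (y \<oplus> z)) (x \<odot> y \<oplus> x \<odot> z)"
| distr: "kat_prov H ((x \<oplus> y) \<odot> z) (x \<odot> z \<oplus> y \<odot> z)"
| test_comm: "is_test a \<Longrightarrow> is_test b \<Longrightarrow> kat_prov H (a \<odot> b) (b \<odot> a)"
| test_idem: "is_test a \<Longrightarrow> kat_prov H (a \<odot> a) a"
| test_top: "is_test a \<Longrightarrow> kat_prov H (a \<oplus> KOne) KOne"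
| test_dist: "is_test a \<Longrightarrow> is_test b \<Longrightarrow> is_test d
    \<Longrightarrow> kat_prov H (a \<oplus> b \<odot> d) ((a \<oplus> b) \<odot> (a \<oplus> d))"
| test_compl_plus: "is_test a \<Longrightarrow> kat_prov H (a \<oplus> KNeg a) KOne"
| test_compl_seq: "is_test a \<Longrightarrow> kat_prov H (a \<odot> KNeg a) KZero"
| star_unfoldl: "kat_prov H (KOne \<oplus> x \<odot> KStar x) (KStar x)"
| star_unfoldr: "kat_prov H (KOne \<oplus> KStar x \<odot> x) (KStar x)"
| star_inductl: "kat_prov H (y \<oplus> x \<odot> z \<oplus> z) z \<Longrightarrow> kat_prov H (KStar x \<odot> y \<oplus> z) z"
| star_inductr: "kat_prov H (y \<oplus> z \<odot> x \<oplus> z) z \<Longrightarrow> kat_prov H (y \<odot> KStar x \<oplus> z) z"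


section \<open>Translation, hypotheses and command equivalence\<close>

fun btrans :: "('f, 'p) bexp \<Rightarrow> ('f, 'p) kat" where
  "btrans (Prim p) = KPrim p"
| "btrans (And e e') = btrans e \<odot> btrans e'"
| "btrans (Or e e') = btrans e \<oplus> btrans e'"
| "btrans (Not e) = KNeg (btrans e)"

fun ksum :: "('f, 'p) kat list \<Rightarrow> ('f, 'p) kat" where
  "ksum [] = KZero"
| "ksum [x] = x"
| "ksum (x # xs) = x \<oplus> ksum xs"

fun ctrans :: "('f, 'p) com \<Rightarrow> ('f, 'p) kat" where
  "ctrans (Skip n) = KOne"
| "ctrans (Assign n x e) = KAssign x e"
| "ctrans (Havoc n x) = KHavoc x"
| "ctrans (Seq c d) = ctrans c \<odot> ctrans d"
| "ctrans (If n gcs) = ksum (map (\<lambda>(e, c). btrans e \<odot> ctrans c) gcs)"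
| "ctrans (Do n gcs) =
    KStar (ksum (map (\<lambda>(e, c). btrans e \<odot> ctrans c) gcs)) \<odot> KNeg (btrans (enab gcs))"

inductive_set Hyp ::
  "'f fun_interp \<Rightarrow> 'p pred_interp \<Rightarrow> (('f, 'p) kat \<times> ('f, 'p) kat) set"
  for F :: "'f fun_interp" and P :: "'p pred_interp" where
  Hyp_false: "(\<And>s. \<not> bval F P e s) \<Longrightarrow> (btrans e, KZero) \<in> Hyp F P"
| Hyp_assign: "(\<And>s. bval F P e0 s \<Longrightarrow> bval F P (bsubst e1 x e) s)
    \<Longrightarrow> (btrans e0 \<odot> KAssign x e \<odot> KNeg (btrans e1), KZero) \<in> Hyp F P"
| Hyp_havoc: "(\<And>s v. bval F P e0 s \<Longrightarrow> bval F P e1 (s(x := v)))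
    \<Longrightarrow> (btrans e0 \<odot> KHavoc x \<odot> KNeg (btrans e1), KZero) \<in> Hyp F P"

definition com_equiv ::
  "'f fun_interp \<Rightarrow> 'p pred_interp \<Rightarrow> ('f, 'p) com \<Rightarrow> ('f, 'p) com \<Rightarrow> bool" where
  "com_equiv F P c d \<longleftrightarrow> kat_prov (Hyp F P) (ctrans c) (ctrans d)"

end

theory Submission
  imports Defs
begin

text \<open>
  The guards of the normal form \<open>gcs\<close> of \<open>c\<close> are jointly enabled exactly when \<open>pc\<close> lies in
  \<open>labs c\<close>, and every body ends with an assignment to \<open>pc\<close> of a label of \<open>c\<close> or of \<open>f\<close>. Two
  facts about \<open>do h od\<close> with a part \<open>g\<close> of \<open>h\<close> then suffice. If the guards of the rest of \<open>h\<close>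
  are disjoint from those of \<open>g\<close>, then \<open>do h od\<close> equals \<open>do g od; do h od\<close>. If they are disjoint
  from a test that the bodies of \<open>g\<close> establish, then \<open>do h od\<close> equals \<open>do g od\<close> after that test.
  The theorem follows by induction on \<open>N\<close>; in the loop case both inequalities are star
  inductions.
\<close>

section \<open>Kleene algebra on canonical representatives\<close>

locale kat_theory =
  fixes H :: "(('f, 'p) kat \<times> ('f, 'p) kat) set"
begin

text \<open>Choosing a representative of each class of provably equal terms, and normalising the result of
  every operation, turns provable equality into equality. The operations ignore the choice of
  representatives in their arguments, so all laws hold unconditionally on terms, at the price of
  \<open>rep x\<close> in place of \<open>x\<close> in the unit and idempotence laws.\<close>

definition rep :: "('f, 'p) kat \<Rightarrow> ('f, 'p) kat" where
  "rep x = (SOME y. kat_prov H x y)"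

definition add (infixl \<open>\<boxplus>\<close> 65) where "x \<boxplus> y = rep (x \<oplus> y)"
definition mul (infixl \<open>\<boxdot>\<close> 70) where "x \<boxdot> y = rep (x \<odot> y)"
definition star where "star x = rep (KStar x)"
definition one where "one = rep KOne"
definition zero where "zero = rep KZero"
definition le (infix \<open>\<preceq>\<close> 50) where "x \<preceq> y \<longleftrightarrow> x \<boxplus> y = rep y"

lemma prov_rep: "kat_prov H x (rep x)"
  unfolding rep_def by (rule someI) (rule kat_prov.refl)

lemma rep_eq_iff: "rep x = rep y \<longleftrightarrow> kat_prov H x y"
proof
  assume "rep x = rep y"
  then show "kat_prov H x y"
    by (metis prov_rep kat_prov.sym kat_prov.trans)
next
  assume "kat_prov H x y"
  \<comment> \<open>The choice in \<open>rep\<close> sees \<open>x\<close> only through the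
    predicate \<open>kat_prov H x\<close>, so equal predicates give the same representative.\<close>
  then have "kat_prov H x = kat_prov H y"
    by (intro ext iffI) (blast intro: kat_prov.sym kat_prov.trans)+
  then show "rep x = rep y"
    by (simp add: rep_def)
qed

lemma rep_prov: "kat_prov H (rep x) x"
  by (rule kat_prov.sym) (rule prov_rep)

lemma rep_rep [simp]: "rep (rep x) = rep x"
  by (simp add: rep_eq_iff rep_prov)

lemma rep_ops [simp]:
  "rep (x \<boxplus> y) = x \<boxplus> y" "rep (x \<boxdot> y) = x \<boxdot> y" "rep (star x) = star x"
  "rep one = one" "rep zero = zero"
  by (simp_all add: add_def mul_def star_def one_def zero_def)

lemma ops_rep [simp]:
  "rep x \<boxplus> y = x \<boxplus> y" "x \<boxplus> rep y = x \<boxplus> y" "rep x \<boxdot> y = x \<boxdot> y" "x \<boxdot> rep y = x \<boxdot> y"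
  "star (rep x) = star x"
  by (auto simp: add_def mul_def star_def rep_eq_iff
      intro!: cong_plus cong_seq cong_star rep_prov kat_prov.refl)

lemma add_assoc: "x \<boxplus> y \<boxplus> z = x \<boxplus> (y \<boxplus> z)"
  using ops_rep(1)[of "x \<oplus> y" z] ops_rep(2)[of x "y \<oplus> z"]
  by (simp add: add_def[of x y] add_def[of y z])
    (simp add: add_def rep_eq_iff plus_assoc)

lemma add_comm: "x \<boxplus> y = y \<boxplus> x"
  by (simp add: add_def rep_eq_iff plus_comm)

lemma add_idem [simp]: "x \<boxplus> x = rep x"
  by (simp add: add_def rep_eq_iff plus_idem)

lemma add_zero [simp]: "x \<boxplus> zero = rep x" "zero \<boxplus> x = rep x"
proof -
  show "x \<boxplus> zero = rep x"
    unfolding zero_def by (simp, simp add: add_def rep_eq_iff plus_zero)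
  then show "zero \<boxplus> x = rep x"
    by (simp add: add_comm)
qed

lemma mul_assoc: "x \<boxdot> y \<boxdot> z = x \<boxdot> (y \<boxdot> z)"
  using ops_rep(3)[of "x \<odot> y" z] ops_rep(4)[of x "y \<odot> z"]
  by (simp add: mul_def[of x y] mul_def[of y z])
    (simp add: mul_def rep_eq_iff seq_assoc)

lemma mul_one [simp]: "x \<boxdot> one = rep x" "one \<boxdot> x = rep x"
  unfolding one_def by (simp_all, simp_all add: mul_def rep_eq_iff seq_one one_seq)

lemma mul_zero [simp]: "x \<boxdot> zero = zero" "zero \<boxdot> x = zero"
  unfolding zero_def by (simp_all, simp_all add: mul_def rep_eq_iff seq_zero zero_seq)

lemma mul_add: "x \<boxdot> (y \<boxplus> z) = x \<boxdot> y \<boxplus> x \<boxdot> z"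
  using distl[of H x y z] unfolding rep_eq_iff[symmetric]
  by (metis add_def mul_def ops_rep)

lemma add_mul: "(x \<boxplus> y) \<boxdot> z = x \<boxdot> z \<boxplus> y \<boxdot> z"
  using distr[of H x y z] unfolding rep_eq_iff[symmetric]
  by (metis add_def mul_def ops_rep)

section \<open>The natural order and its monotonicity laws\<close>

lemma le_iff_prov: "x \<preceq> y \<longleftrightarrow> kat_prov H (x \<oplus> y) y"
  by (simp add: le_def add_def rep_eq_iff)

lemma le_rep [simp]: "rep x \<preceq> y \<longleftrightarrow> x \<preceq> y" "x \<preceq> rep y \<longleftrightarrow> x \<preceq> y"
  by (simp_all add: le_def)

lemma le_refl [simp]: "x \<preceq> x"
  by (simp add: le_def)

lemma le_trans [trans]: "x \<preceq> y \<Longrightarrow> y \<preceq> z \<Longrightarrow> x \<preceq> z"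
  unfolding le_def by (metis add_assoc ops_rep(1,2))

lemma le_antisym: "x \<preceq> y \<Longrightarrow> y \<preceq> x \<Longrightarrow> rep x = rep y"
  unfolding le_def by (metis add_comm)

lemma add_le_iff [simp]: "x \<boxplus> y \<preceq> z \<longleftrightarrow> x \<preceq> z \<and> y \<preceq> z"
  unfolding le_def by (metis add_assoc add_comm add_idem ops_rep(1,2))

lemma le_add: "x \<preceq> x \<boxplus> y" "y \<preceq> x \<boxplus> y"
  using add_le_iff le_refl by blast+

lemma zero_le [simp]: "zero \<preceq> x"
  by (simp add: le_def)

lemma mul_mono: "x \<preceq> x' \<Longrightarrow> y \<preceq> y' \<Longrightarrow> x \<boxdot> y \<preceq> x' \<boxdot> y'"
  unfolding le_def by (metis add_mul mul_add add_assoc add_idem rep_ops(2) ops_rep)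

section \<open>Iteration: unfolding and induction\<close>

lemma star_unfold: "one \<boxplus> x \<boxdot> star x = star x" "one \<boxplus> star x \<boxdot> x = star x"
  using star_unfoldl[of H x] star_unfoldr[of H x] unfolding rep_eq_iff[symmetric]
  by (metis add_def mul_def star_def one_def ops_rep)+

lemma star_induct_left:
  assumes "y \<preceq> z" "x \<boxdot> z \<preceq> z"
  shows "star x \<boxdot> y \<preceq> z"
proof -
  have "y \<boxplus> x \<boxdot> z \<preceq> z"
    using assms by simp
  then have "y \<oplus> x \<odot> z \<preceq> z"
    by (metis add_def mul_def le_rep(1) ops_rep(2))
  then have "KStar x \<odot> y \<preceq> z"
    unfolding le_iff_prov by (rule star_inductl)
  then show ?thesis
    by (metis mul_def star_def le_rep(1) ops_rep(3))
qed

lemma star_induct_right: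
  assumes "y \<preceq> z" "z \<boxdot> x \<preceq> z"
  shows "y \<boxdot> star x \<preceq> z"
proof -
  have "y \<boxplus> z \<boxdot> x \<preceq> z"
    using assms by simp
  then have "y \<oplus> z \<odot> x \<preceq> z"
    by (metis add_def mul_def le_rep(1) ops_rep(2))
  then have "y \<odot> KStar x \<preceq> z"
    unfolding le_iff_prov by (rule star_inductr)
  then show ?thesis
    by (metis mul_def star_def le_rep(1) ops_rep(4))
qed

lemma one_le_star: "one \<preceq> star x"
  by (metis star_unfold(1) le_add(1))

lemma mul_star_le: "x \<boxdot> star x \<preceq> star x" "star x \<boxdot> x \<preceq> star x"
  by (metis star_unfold le_add(2))+

lemma mul_one_le: "x \<preceq> one \<Longrightarrow> x \<boxdot> y \<preceq> y" "x \<preceq> one \<Longrightarrow> y \<boxdot> x \<preceq> y"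
  using mul_mono[of x one y y] mul_mono[of y y x one] by simp_all

lemma star_le_star:
  assumes "x \<preceq> y"
  shows "star x \<preceq> star y"
proof -
  have "star x \<boxdot> one \<preceq> star y"
    by (rule star_induct_left)
      (auto intro: one_le_star le_trans[OF mul_mono[OF assms le_refl] mul_star_le(1)])
  then show ?thesis by simp
qed

lemma star_mul_star: "star x \<boxdot> star x = star x"
proof -
  have "star x \<boxdot> star x \<preceq> star x"
    by (rule star_induct_left) (auto intro: mul_star_le)
  moreover have "star x \<preceq> star x \<boxdot> star x"
    using mul_mono[OF one_le_star[of x] le_refl[of "star x"]] by simp
  ultimately show ?thesis
    using le_antisym by fastforce
qed

lemma star_zero [simp]: "star zero = one"
  using star_unfold(1)[of zero] by simp

end


section \<open>Guards and bodies of the normal form\<close>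

lemma bval_enab: "bval F P (enab gcs) s \<longleftrightarrow> (\<exists>(e, c)\<in>set gcs. bval F P e s)"
  by (induction gcs rule: enab.induct) auto

lemma bval_enab_Cons: "bval F P (enab ((e, c) # gcs)) s \<longleftrightarrow> bval F P e s \<or> bval F P (enab gcs) s"
  by (auto simp: bval_enab)

lemma bval_enab_append:
  "bval F P (enab (xs @ ys)) s \<longleftrightarrow> bval F P (enab xs) s \<or> bval F P (enab ys) s"
  by (auto simp: bval_enab)

lemma bval_enab_entries:
  "bval F P (enab (entries pc n gcs)) s \<longleftrightarrow> s pc = n \<and> bval F P (enab gcs) s"
  by (force simp: bval_enab entries_def)

lemma labs_simps:
  "labs (Skip n) = {n}" "labs (Assign n x e) = {n}" "labs (Havoc n x) = {n}"
  "labs (Seq c d) = labs c \<union> labs d"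
  "labs (If n gcs) = insert n (\<Union>(e, c)\<in>set gcs. labs c)"
  "labs (Do n gcs) = insert n (\<Union>(e, c)\<in>set gcs. labs c)"
  by (auto simp: labs_def)

lemma lab_in_labs: "lab c \<in> labs c"
  by (induction c) (auto simp: labs_simps)

text \<open>In the \<open>If\<close> case the entries cover every state with \<open>pc = n\<close>
  because \<open>wf_com\<close> makes the guards jointly valid; in the \<open>Do\<close> case the
  exit branch covers the states where no guard holds.\<close>

lemma N_guards:
  assumes "N pc c f gcs" "wf_com F P c"
  shows "bval F P (enab gcs) s \<longleftrightarrow> s pc \<in> labs c"
proof -
  \<comment> \<open>The hypotheses for the branches arrive as a \<open>list_all2\<close>, so the
    components are combined by induction along both lists, once for \<open>If\<close> and
    \<open>Do\<close>.\<close>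
  have concat: "bval F P (enab (concat gss)) s \<longleftrightarrow> (\<exists>(e, c)\<in>set gcs. s pc \<in> labs c)"
    if "list_all2 (\<lambda>gc g. N pc (snd gc) f g \<and>
          (wf_com F P (snd gc) \<longrightarrow> bval F P (enab g) s = (s pc \<in> labs (snd gc)))) gcs gss"
      "\<forall>(e, c)\<in>set gcs. wf_com F P c" for f gcs gss
    using that
  proof (induction rule: list_all2_induct)
    case Nil
    then show ?case by simp
  next
    case (Cons x xs y ys)
    then show ?case by (cases x) (simp add: bval_enab_append)
  qed
  from assms show ?thesis
  proof (induction rule: N.induct)
    case (N_If f gcs gss n)
    then show ?case
      by (auto simp: bval_enab_append bval_enab_entries concat labs_simps)
  next
    case (N_Do n gcs gss f)
    then show ?case
      by (auto simp: bval_enab_append bval_enab_Cons bval_enab_entries concat labs_simps)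
  qed (auto simp: labs_simps bval_enab_append)
qed

text \<open>Inner exits stay among the listed labels: the first half of a \<open>Seq\<close> exits
  to a label of the second half, a \<open>Do\<close> body to the label of its loop. The syntactic
  form exposes the final assignment, from which postconditions about \<open>pc\<close> are read
  off.\<close>

lemma N_bodies:
  assumes "N pc c f gcs" "(e, d) \<in> set gcs"
  shows "\<exists>k \<in> insert f (labs c). d = set_pc pc k \<or> (\<exists>d'. d = Seq d' (set_pc pc k))"
proof -
  have branch: "\<exists>(e, c)\<in>set gcs. \<exists>k \<in> insert f (labs c). d = set_pc pc k \<or> (\<exists>d'. d = Seq d' (set_pc pc k))"
    if "list_all2 (\<lambda>gc g. N pc (snd gc) f g \<and> ((e, d) \<in> set g \<longrightarrow>
          (\<exists>k \<in> insert f (labs (snd gc)). d = set_pc pc k \<or> (\<exists>d'. d = Seq d' (set_pc pc k))))) gcs gss"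
      "(e, d) \<in> set (concat gss)" for f gcs gss
    using that by (induction rule: list_all2_induct) (auto split: prod.splits)
  have entry: "\<exists>(e, c)\<in>set gcs. d = set_pc pc (lab c)" if "(e, d) \<in> set (entries pc n gcs)" for n gcs
    using that by (auto simp: entries_def)
  from assms show ?thesis
  proof (induction rule: N.induct)
    case (N_Seq c0 c1 gcs0 f gcs1)
    then show ?case
      using lab_in_labs[of c1] by (auto simp: labs_simps)
  next
    case (N_If f gcs gss n)
    then consider "(e, d) \<in> set (entries pc n gcs)" | "(e, d) \<in> set (concat gss)"
      by auto
    then show ?case
    proof cases
      case 1
      from entry[OF 1] show ?thesis
        using lab_in_labs by (fastforce simp: labs_simps)
    next
      case 2
      from branch[OF N_If.IH 2] show ?thesis
        by (fastforce simp: labs_simps)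
    qed
  next
    case (N_Do n gcs gss f)
    then consider "(e, d) \<in> set (entries pc n gcs)" | "d = set_pc pc f" | "(e, d) \<in> set (concat gss)"
      by auto
    then show ?case
    proof cases
      case 1
      from entry[OF 1] show ?thesis
        using lab_in_labs by (fastforce simp: labs_simps)
    next
      case 2
      then show ?thesis by blast
    next
      case 3
      from branch[OF N_Do.IH 3] show ?thesis
        by (fastforce simp: labs_simps)
    qed
  qed (auto simp: labs_simps)
qed

text \<open>Used to tell components apart by their labels. A position \<open>j\<close> is produced
  rather than a list member, to match \<open>distinct_branch_labels\<close>.\<close>

lemma N_concat_guardE:
  assumes "list_all2 (\<lambda>gc g. N pc (snd gc) k g) gcs gss"
    and "\<forall>(e, c)\<in>set gcs. wf_com F P c"
    and "(e, d) \<in> set (concat gss)" "bval F P e s"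
  obtains j where "j < length gcs" "(e, d) \<in> set (gss ! j)" "s pc \<in> labs (snd (gcs ! j))"
proof -
  from assms(3) obtain g where "g \<in> set gss" "(e, d) \<in> set g"
    by auto
  then obtain j where j: "j < length gss" "(e, d) \<in> set (gss ! j)"
    by (metis in_set_conv_nth)
  then have "j < length gcs" "N pc (snd (gcs ! j)) k (gss ! j)"
    using assms(1) by (auto simp: list_all2_conv_all_nth)
  moreover from this have "wf_com F P (snd (gcs ! j))"
    using assms(2) nth_mem by fastforce
  ultimately have "s pc \<in> labs (snd (gcs ! j))"
    using N_guards assms(4) j(2) by (fastforce simp: bval_enab)
  then show thesis
    using that j \<open>j < length gcs\<close> by blast
qed

lemma distinct_branch_labels:
  assumes "distinct (concat (map (\<lambda>(e, c). lab_list c) gcs))"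
    and "i < length gcs" "j < length gcs" "i \<noteq> j"
  shows "labs (snd (gcs ! i)) \<inter> labs (snd (gcs ! j)) = {}"
  using assms
proof (induction gcs arbitrary: i j)
  case (Cons a gcs)
  then show ?case
    by (cases i; cases j) (force simp: labs_def case_prod_unfold dest: nth_mem)+
qed simp

section \<open>Loops modulo the hypotheses\<close>

lemma ival_isubst: "ival F (isubst e x a) s = ival F e (s(x := ival F a s))"
  by (induction e) (auto cong: map_cong)

lemma bval_bsubst: "bval F P (bsubst e x a) s = bval F P e (s(x := ival F a s))"
proof (induction e)
  case (Prim p)
  then show ?case by (cases p) (simp_all add: ival_isubst fun_upd_def comp_def)
qed auto

lemma is_test_btrans: "is_test (btrans e)"
  by (induction e) auto

locale gcl_theory = kat_theory "Hyp F P"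
  for F :: "'f fun_interp" and P :: "'p pred_interp"
begin

notation add (infixl \<open>\<boxplus>\<close> 65)
notation mul (infixl \<open>\<boxdot>\<close> 70)
notation le (infix \<open>\<preceq>\<close> 50)

section \<open>Images of expressions, commands and branch lists in the algebra\<close>

definition B :: "('f, 'p) bexp \<Rightarrow> ('f, 'p) kat" where
  "B e = rep (btrans e)"

definition C :: "('f, 'p) com \<Rightarrow> ('f, 'p) kat" where
  "C c = rep (ctrans c)"

definition G :: "('f, 'p) gcs \<Rightarrow> ('f, 'p) kat" where
  "G gcs = rep (ksum (map (\<lambda>(e, c). btrans e \<odot> ctrans c) gcs))"

definition loop :: "('f, 'p) gcs \<Rightarrow> ('f, 'p) kat" where
  "loop gcs = star (G gcs) \<boxdot> B (Not (enab gcs))"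

lemma rep_trans [simp]: "rep (B e) = B e" "rep (C c) = C c" "rep (G gcs) = G gcs"
  "rep (loop gcs) = loop gcs"
  by (simp_all add: B_def C_def G_def loop_def)

lemma B_And: "B (And e e') = B e \<boxdot> B e'"
  by (simp add: B_def) (simp add: mul_def)

lemma C_simps:
  "C (Skip n) = one" "C (Seq c d) = C c \<boxdot> C d" "C (If n gcs) = G gcs" "C (Do n gcs) = loop gcs"
  by (simp_all add: B_def C_def G_def loop_def, simp_all add: one_def mul_def star_def)
    (metis mul_def ops_rep(3))

section \<open>Tests, and the transfer of semantic validity to them\<close>

lemma B_compl: "B e \<boxplus> B (Not e) = one" "B e \<boxdot> B (Not e) = zero"
  using test_compl_plus[OF is_test_btrans, of "Hyp F P" e]
    test_compl_seq[OF is_test_btrans, of "Hyp F P" e]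
  by (simp_all add: B_def) (simp_all add: add_def mul_def one_def zero_def rep_eq_iff)

lemma B_false: "(\<And>s. \<not> bval F P e s) \<Longrightarrow> B e = zero"
  by (simp add: B_def zero_def rep_eq_iff Hyp_false kat_prov.hyp)

lemma B_le_one [simp]: "B e \<preceq> one"
  using B_compl(1) le_add(1) by metis

text \<open>\<open>e\<close> together with the negation of \<open>e'\<close> is unsatisfiable, hence
  \<open>zero\<close>; splitting \<open>one\<close> into \<open>B e'\<close> and its complement then
  leaves \<open>B e = B e \<boxdot> B e'\<close>.\<close>

lemma B_mono:
  assumes "\<And>s. bval F P e s \<Longrightarrow> bval F P e' s"
  shows "B e \<preceq> B e'"
proof -
  have "B e \<boxdot> B (Not e') = zero"
    unfolding B_And[symmetric] by (rule B_false) (use assms in auto)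
  then have "B e = B e \<boxdot> B e'"
    using mul_add[of "B e" "B e'" "B (Not e')"] by (simp add: B_compl)
  then show ?thesis
    by (metis B_le_one mul_one_le(1))
qed

lemma B_cong: "(\<And>s. bval F P e s \<longleftrightarrow> bval F P e' s) \<Longrightarrow> B e = B e'"
  using le_antisym[OF B_mono B_mono, of e e'] by simp

lemma B_true:
  assumes "\<And>s. bval F P e s"
  shows "B e = one"
  using B_compl(1)[of e] B_false[of "Not e"] assms by simp

lemma B_mul_absorb: "(\<And>s. bval F P e s \<Longrightarrow> bval F P e' s) \<Longrightarrow> B e \<boxdot> B e' = B e"
  "(\<And>s. bval F P e s \<Longrightarrow> bval F P e' s) \<Longrightarrow> B e' \<boxdot> B e = B e"
  by (auto simp flip: B_And intro!: B_cong)

lemma B_mul_disjoint: "(\<And>s. bval F P e s \<Longrightarrow> \<not> bval F P e' s) \<Longrightarrow> B e \<boxdot> B e' = zero"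
  by (auto simp flip: B_And intro!: B_false)

lemma B_idem [simp]: "B e \<boxdot> B e = B e"
  by (simp add: B_mul_absorb)

text \<open>The hypothesis on assignments, taken with a valid precondition \<open>t\<close>, says
  that \<open>e\<close> cannot fail afterwards; the summand with the complement of \<open>e\<close>
  therefore vanishes.\<close>

lemma set_pc_absorb:
  assumes "\<And>s. bval F P e (s(pc := k))"
  shows "C (set_pc pc k) \<boxdot> B e = C (set_pc pc k)"
proof -
  define t :: "('f, 'p) bexp" where "t = Prim (Eq (Lit 0) (Lit 0))"
  have "kat_prov (Hyp F P) (btrans t \<odot> KAssign pc (Lit k) \<odot> KNeg (btrans e)) KZero"
    by (intro kat_prov.hyp Hyp_assign) (simp add: bval_bsubst assms)
  then have "B t \<boxdot> C (set_pc pc k) \<boxdot> B (Not e) = zero"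
    unfolding rep_eq_iff[symmetric] by (simp add: B_def C_def zero_def) (metis mul_def ops_rep(3))
  moreover have "B t = one"
    by (rule B_true) (simp add: t_def)
  ultimately have "C (set_pc pc k) \<boxdot> B (Not e) = zero"
    by simp
  then show ?thesis
    using mul_add[of "C (set_pc pc k)" "B e" "B (Not e)"] by (simp add: B_compl)
qed

lemma set_pc_disjoint:
  assumes "\<And>s. \<not> bval F P e (s(pc := k))"
  shows "C (set_pc pc k) \<boxdot> B e = zero"
  using set_pc_absorb[of "Not e" pc k] assms B_mul_disjoint[of "Not e" e]
  by (metis bval.simps(4) mul_assoc mul_zero(1))

section \<open>Sums of guarded branches\<close>

lemma G_Nil [simp]: "G [] = zero"
  by (simp add: G_def zero_def)

lemma G_Cons: "G ((e, c) # gcs) = B e \<boxdot> C c \<boxplus> G gcs"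
proof -
  have [simp]: "rep (x \<oplus> y) = rep x \<boxplus> rep y" "rep (x \<odot> y) = rep x \<boxdot> rep y" for x y
    by (simp_all, simp_all add: add_def mul_def)
  show ?thesis
    by (cases gcs) (simp_all add: B_def C_def G_def zero_def[symmetric])
qed

text \<open>Products distribute over the sum and \<open>\<boxplus>\<close> is the least upper bound,
  so an upper bound can be checked branch by branch inside any context.\<close>

lemma mul_G_mul_le_iff:
  "x \<boxdot> G gcs \<boxdot> y \<preceq> z \<longleftrightarrow> (\<forall>(e, c)\<in>set gcs. x \<boxdot> B e \<boxdot> C c \<boxdot> y \<preceq> z)"
  by (induction gcs) (auto simp: G_Cons mul_add add_mul mul_assoc)

lemma G_mul_le_iff: "G gcs \<boxdot> y \<preceq> z \<longleftrightarrow> (\<forall>(e, c)\<in>set gcs. B e \<boxdot> C c \<boxdot> y \<preceq> z)"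
  using mul_G_mul_le_iff[of one gcs y z] by simp

lemma mul_G_le_iff: "x \<boxdot> G gcs \<preceq> z \<longleftrightarrow> (\<forall>(e, c)\<in>set gcs. x \<boxdot> B e \<boxdot> C c \<preceq> z)"
  using mul_G_mul_le_iff[of x gcs one z] by simp

lemma G_le_iff: "G gcs \<preceq> z \<longleftrightarrow> (\<forall>(e, c)\<in>set gcs. B e \<boxdot> C c \<preceq> z)"
  using mul_G_le_iff[of one gcs z] by simp

lemma branch_le_G: "(e, c) \<in> set gcs \<Longrightarrow> B e \<boxdot> C c \<preceq> G gcs"
  using G_le_iff[of gcs "G gcs"] by auto

lemma G_mono: "set g \<subseteq> set h \<Longrightarrow> G g \<preceq> G h"
  by (auto simp: G_le_iff intro: branch_le_G)

section \<open>Unfolding, splitting and restricting loops\<close>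

lemma G_mul_loop_le: "G gcs \<boxdot> loop gcs \<preceq> loop gcs"
  unfolding loop_def mul_assoc[symmetric] by (intro mul_mono mul_star_le le_refl)

lemma exit_le_loop: "B (Not (enab gcs)) \<preceq> loop gcs"
  using mul_mono[OF one_le_star le_refl] by (fastforce simp: loop_def)

lemma branch_mul_loop_le: "(e, c) \<in> set gcs \<Longrightarrow> B e \<boxdot> C c \<boxdot> loop gcs \<preceq> loop gcs"
  using G_mul_loop_le[of gcs] by (auto simp: G_mul_le_iff)

lemma loop_unfold: "loop gcs = B (Not (enab gcs)) \<boxplus> G gcs \<boxdot> loop gcs"
  unfolding loop_def by (metis star_unfold(1) add_mul mul_one(2) mul_assoc rep_trans(1))

text \<open>Exhausting \<open>g\<close> first loses no run: a branch outside \<open>g\<close> can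
  fire only when all guards of \<open>g\<close> are false, that is, when \<open>loop g\<close> may
  already stop.\<close>

lemma loop_split:
  assumes sub: "set g \<subseteq> set h"
    and disj: "\<And>e c s. (e, c) \<in> set h \<Longrightarrow> (e, c) \<notin> set g \<Longrightarrow> bval F P e s \<Longrightarrow> \<not> bval F P (enab g) s"
  shows "loop g \<boxdot> loop h = loop h"
proof -
  have "loop g \<boxdot> loop h \<preceq> star (G h) \<boxdot> one \<boxdot> loop h"
    unfolding loop_def[of g]
    by (intro mul_mono star_le_star G_mono sub le_refl B_le_one)
  also have "star (G h) \<boxdot> one \<boxdot> loop h = loop h"
    by (simp add: loop_def star_mul_star flip: mul_assoc)
  finally have 1: "loop g \<boxdot> loop h \<preceq> loop h" .
  have exit: "B (Not (enab g)) \<boxdot> x \<preceq> loop g \<boxdot> x" for x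
    by (intro mul_mono exit_le_loop le_refl)
  \<comment> \<open>Star induction on \<open>h\<close>: a branch of \<open>g\<close> is absorbed by
    the leading \<open>loop g\<close>, any other branch is handled by stopping that loop at
    once.\<close>
  have "loop h \<preceq> loop g \<boxdot> loop h"
    unfolding loop_def[of h]
  proof (rule star_induct_left)
    have "B (Not (enab h)) = B (Not (enab g)) \<boxdot> B (Not (enab h))"
      by (rule B_mul_absorb(2)[symmetric]) (use sub in \<open>auto simp: bval_enab\<close>)
    also have "\<dots> \<preceq> loop g \<boxdot> loop h"
      by (intro mul_mono exit_le_loop)
    finally show "B (Not (enab h)) \<preceq> loop g \<boxdot> (star (G h) \<boxdot> B (Not (enab h)))"
      by (simp add: loop_def)
    have "B e \<boxdot> C c \<boxdot> (loop g \<boxdot> loop h) \<preceq> loop g \<boxdot> loop h" if ec: "(e, c) \<in> set h" for e c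
    proof (cases "(e, c) \<in> set g")
      case True
      have "B e \<boxdot> C c \<boxdot> loop g \<boxdot> loop h \<preceq> loop g \<boxdot> loop h"
        by (intro mul_mono branch_mul_loop_le True le_refl)
      then show ?thesis
        by (simp add: mul_assoc)
    next
      case False
      \<comment> \<open>The inequality already shown merges both loops; disjointness then permits
        putting the exit test of \<open>g\<close> in front of \<open>e\<close>.\<close>
      have "B e \<boxdot> C c \<boxdot> (loop g \<boxdot> loop h) \<preceq> B e \<boxdot> C c \<boxdot> loop h"
        by (intro mul_mono 1 le_refl)
      also have "B e \<boxdot> C c \<boxdot> loop h = B (Not (enab g)) \<boxdot> (B e \<boxdot> C c \<boxdot> loop h)"
        using disj[OF ec False] by (simp add: B_mul_absorb(2) flip: mul_assoc)
      also have "\<dots> \<preceq> B (Not (enab g)) \<boxdot> loop h"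
        by (intro mul_mono branch_mul_loop_le ec le_refl)
      also have "\<dots> \<preceq> loop g \<boxdot> loop h"
        by (rule exit)
      finally show ?thesis .
    qed
    then show "G h \<boxdot> (loop g \<boxdot> (star (G h) \<boxdot> B (Not (enab h)))) \<preceq>
      loop g \<boxdot> (star (G h) \<boxdot> B (Not (enab h)))"
      by (auto simp: G_mul_le_iff simp flip: loop_def)
  qed
  with 1 show ?thesis
    using le_antisym by fastforce
qed

text \<open>While \<open>i\<close> holds only branches of \<open>g\<close> can fire, and these
  re-establish \<open>i\<close>; hence \<open>i\<close> can be carried through the whole iteration
  up to the exit test.\<close>

lemma loop_restrict:
  assumes sub: "set g \<subseteq> set h"
    and disj: "\<And>e c s. (e, c) \<in> set h \<Longrightarrow> (e, c) \<notin> set g \<Longrightarrow> bval F P e s \<Longrightarrow> \<not> bval F P i s"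
    and inv: "\<And>e c. (e, c) \<in> set g \<Longrightarrow> C c \<boxdot> B i = C c"
  shows "B i \<boxdot> loop h = B i \<boxdot> loop g"
proof -
  \<comment> \<open>Stated for an arbitrary part \<open>k\<close> of \<open>h\<close>, since it is
    needed both for \<open>h\<close> and for \<open>g\<close> itself.\<close>
  have IG: "B i \<boxdot> G k \<preceq> G g \<boxdot> B i" if "set k \<subseteq> set h" for k
    unfolding mul_G_le_iff
  proof clarify
    fix e c assume ec: "(e, c) \<in> set k"
    show "B i \<boxdot> B e \<boxdot> C c \<preceq> G g \<boxdot> B i"
    proof (cases "(e, c) \<in> set g")
      case True
      have "B i \<boxdot> B e \<boxdot> C c \<preceq> B e \<boxdot> C c"
        by (intro mul_mono mul_one_le B_le_one le_refl)
      also have "\<dots> = B e \<boxdot> C c \<boxdot> B i"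
        using inv[OF True] by (simp add: mul_assoc)
      also have "\<dots> \<preceq> G g \<boxdot> B i"
        by (intro mul_mono branch_le_G True le_refl)
      finally show ?thesis .
    next
      case False
      then have "B i \<boxdot> B e = zero"
        using disj[of e c] ec that by (intro B_mul_disjoint) auto
      then show ?thesis by simp
    qed
  qed
  have Istar: "B i \<boxdot> star (G k) \<preceq> star (G g) \<boxdot> B i" if "set k \<subseteq> set h" for k
  proof (rule star_induct_right)
    show "B i \<preceq> star (G g) \<boxdot> B i"
      using mul_mono[OF one_le_star le_refl] by fastforce
    have "star (G g) \<boxdot> B i \<boxdot> G k \<preceq> star (G g) \<boxdot> (G g \<boxdot> B i)"
      unfolding mul_assoc by (intro mul_mono IG that le_refl)
    also have "\<dots> \<preceq> star (G g) \<boxdot> B i"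
      unfolding mul_assoc[symmetric] by (intro mul_mono mul_star_le le_refl)
    finally show "star (G g) \<boxdot> B i \<boxdot> G k \<preceq> star (G g) \<boxdot> B i" .
  qed
  have exit: "B i \<boxdot> B (Not (enab h)) = B i \<boxdot> B (Not (enab g))"
    unfolding B_And[symmetric] using sub disj by (intro B_cong) (fastforce simp: bval_enab)
  \<comment> \<open>Retains a copy of \<open>i\<close> in front of the final test, where
    \<open>exit\<close> can exchange the exit tests of \<open>h\<close> and
    \<open>g\<close>.\<close>
  have *: "B i \<boxdot> (star (G k) \<boxdot> B b) \<preceq> B i \<boxdot> (star (G g) \<boxdot> (B i \<boxdot> B b))" if "set k \<subseteq> set h" for k b
  proof -
    have "B i \<boxdot> (star (G k) \<boxdot> B b) = B i \<boxdot> (B i \<boxdot> star (G k)) \<boxdot> B b"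
      by (simp flip: mul_assoc)
    also have "\<dots> \<preceq> B i \<boxdot> (star (G g) \<boxdot> B i) \<boxdot> B b"
      by (intro mul_mono Istar that le_refl)
    finally show ?thesis
      by (simp add: mul_assoc)
  qed
  have "B i \<boxdot> loop h \<preceq> B i \<boxdot> (star (G g) \<boxdot> (B i \<boxdot> B (Not (enab g))))"
    using *[of h "Not (enab h)"] by (simp add: loop_def exit)
  also have "\<dots> \<preceq> B i \<boxdot> loop g"
    unfolding loop_def by (intro mul_mono mul_one_le B_le_one le_refl)
  finally have 1: "B i \<boxdot> loop h \<preceq> B i \<boxdot> loop g" .
  have "B i \<boxdot> loop g \<preceq> B i \<boxdot> (star (G g) \<boxdot> (B i \<boxdot> B (Not (enab h))))"
    using *[of g "Not (enab g)"] sub by (simp add: loop_def exit)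
  also have "\<dots> \<preceq> B i \<boxdot> loop h"
    unfolding loop_def by (intro mul_mono mul_one_le B_le_one star_le_star G_mono sub le_refl)
  finally show ?thesis
    using 1 le_antisym by fastforce
qed

lemma set_pc_loop_restrict:
  assumes "set g \<subseteq> set h"
    and "\<And>e c s. (e, c) \<in> set h \<Longrightarrow> (e, c) \<notin> set g \<Longrightarrow> bval F P e s \<Longrightarrow> \<not> bval F P i s"
    and "\<And>e c. (e, c) \<in> set g \<Longrightarrow> C c \<boxdot> B i = C c"
    and "\<And>s. bval F P i (s(pc := k))"
  shows "C (set_pc pc k) \<boxdot> loop h = C (set_pc pc k) \<boxdot> loop g"
proof -
  have "B i \<boxdot> loop h = B i \<boxdot> loop g"
    by (rule loop_restrict; fact assms)
  then show ?thesis
    using set_pc_absorb[OF assms(4)] by (metis mul_assoc)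
qed

lemma set_pc_loop_exit:
  assumes "\<And>s. s pc = k \<Longrightarrow> \<not> bval F P (enab gcs) s"
  shows "C (set_pc pc k) \<boxdot> loop gcs = C (set_pc pc k)"
proof -
  have "C (set_pc pc k) \<boxdot> loop gcs = C (set_pc pc k) \<boxdot> loop []"
    using assms by (intro set_pc_loop_restrict[where i = "test_pc pc k"]) (auto simp: bval_enab)
  \<comment> \<open>The default \<open>enab []\<close> is false, so the exit test of the empty loop
    is \<open>one\<close>, and so is its star.\<close>
  also have "loop [] = one"
    by (simp add: loop_def B_true)
  finally show ?thesis by simp
qed


section \<open>Correctness of the normal form\<close>

lemma N_body_absorb:
  assumes "N pc c f gcs" "(e, d) \<in> set gcs" "\<And>s. s pc \<in> insert f (labs c) \<Longrightarrow> bval F P i s"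
  shows "C d \<boxdot> B i = C d"
proof -
  from N_bodies[OF assms(1,2)] obtain k where k: "k \<in> insert f (labs c)"
    "d = set_pc pc k \<or> (\<exists>d'. d = Seq d' (set_pc pc k))"
    by blast
  have "C (set_pc pc k) \<boxdot> B i = C (set_pc pc k)"
    using assms(3) k(1) by (intro set_pc_absorb) auto
  then show ?thesis
    using k(2) by (auto simp: C_simps mul_assoc)
qed

text \<open>The invariant must be a boolean expression. By \<open>N_guards\<close>,
  \<open>Or (enab g) (test_pc pc f)\<close> expresses that \<open>pc\<close> lies in
  \<open>insert f (labs c)\<close>.\<close>

lemma N_loop_restrict:
  assumes "N pc c f g" "wf_com F P c" "set g \<subseteq> set h"
    and "\<And>e d s. (e, d) \<in> set h \<Longrightarrow> (e, d) \<notin> set g \<Longrightarrow> bval F P e s \<Longrightarrow> s pc \<notin> insert f (labs c)"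
  shows "C (set_pc pc (lab c)) \<boxdot> loop h = C (set_pc pc (lab c)) \<boxdot> loop g"
proof (rule set_pc_loop_restrict[where i = "Or (enab g) (test_pc pc f)"])
  have i: "bval F P (Or (enab g) (test_pc pc f)) s \<longleftrightarrow> s pc \<in> insert f (labs c)" for s
    using N_guards[OF assms(1,2)] by auto
  show "\<not> bval F P (Or (enab g) (test_pc pc f)) s"
    if "(e, d) \<in> set h" "(e, d) \<notin> set g" "bval F P e s" for e d s
    using assms(4)[OF that] i by blast
  show "C d \<boxdot> B (Or (enab g) (test_pc pc f)) = C d" if "(e, d) \<in> set g" for e d
    using i by (intro N_body_absorb[OF assms(1) that]) blast
  show "bval F P (Or (enab g) (test_pc pc f)) (s(pc := lab c))" for s
    unfolding i using lab_in_labs[of c] by simp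
qed (fact assms(3))

text \<open>The exit summand of \<open>loop_unfold\<close> vanishes after the assignment.\<close>

lemma set_pc_loop_step:
  assumes "\<And>s. s pc = k \<Longrightarrow> bval F P (enab gcs) s"
  shows "C (set_pc pc k) \<boxdot> loop gcs = C (set_pc pc k) \<boxdot> G gcs \<boxdot> loop gcs"
proof -
  have "C (set_pc pc k) \<boxdot> B (Not (enab gcs)) = zero"
    using assms by (intro set_pc_disjoint) auto
  then show ?thesis
    by (subst loop_unfold) (simp add: mul_add mul_assoc)
qed

lemma set_pc_test [simp]: "C (set_pc pc k) \<boxdot> B (test_pc pc k) = C (set_pc pc k)"
  by (rule set_pc_absorb) simp

lemma set_pc_test_mul [simp]: "C (set_pc pc k) \<boxdot> (B (test_pc pc k) \<boxdot> x) = C (set_pc pc k) \<boxdot> x"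
  by (simp flip: mul_assoc)

text \<open>Exactly one iteration takes place: the body leaves \<open>pc\<close> at
  \<open>f\<close>, which disables the only guard.\<close>

lemma normal_form_atomic:
  assumes "C d = x \<boxdot> C (set_pc pc f)" "f \<noteq> n"
  shows "C (set_pc pc n) \<boxdot> loop [(test_pc pc n, d)] = C (set_pc pc n) \<boxdot> C d"
proof -
  have "C (set_pc pc n) \<boxdot> loop [(test_pc pc n, d)] =
      C (set_pc pc n) \<boxdot> G [(test_pc pc n, d)] \<boxdot> loop [(test_pc pc n, d)]"
    by (rule set_pc_loop_step) simp
  also have "\<dots> = C (set_pc pc n) \<boxdot> B (test_pc pc n) \<boxdot> (C d \<boxdot> loop [(test_pc pc n, d)])"
    by (simp add: G_Cons mul_assoc)
  also have "C d \<boxdot> loop [(test_pc pc n, d)] = C d"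
    using assms(2) by (simp add: assms(1) mul_assoc set_pc_loop_exit)
  finally show ?thesis
    by simp
qed

text \<open>\<open>loop_split\<close> lets \<open>gcs0\<close> run first, which by \<open>c\<close>
  ends at \<open>lab d\<close>; from there only branches of \<open>gcs1\<close> can fire, so the
  whole loop shrinks to \<open>loop gcs1\<close>.\<close>

lemma normal_form_seq:
  assumes N: "N pc c (lab d) gcs0" "N pc d f gcs1"
    and wf: "wf_com F P c" "wf_com F P d"
    and ok: "labs c \<inter> labs d = {}" "f \<notin> labs c"
    and c: "C (set_pc pc (lab c)) \<boxdot> loop gcs0 = C (add_pc pc c) \<boxdot> C (set_pc pc (lab d))"
    and d: "C (set_pc pc (lab d)) \<boxdot> loop gcs1 = C (add_pc pc d) \<boxdot> C (set_pc pc f)"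
  shows "C (set_pc pc (lab c)) \<boxdot> loop (gcs0 @ gcs1) =
    C (add_pc pc c) \<boxdot> C (add_pc pc d) \<boxdot> C (set_pc pc f)"
proof -
  have guard0: "s pc \<in> labs c" if "(e, b) \<in> set gcs0" "bval F P e s" for e b s
    using N_guards[OF N(1) wf(1)] that by (force simp: bval_enab)
  have guard1: "s pc \<in> labs d" if "(e, b) \<in> set gcs1" "bval F P e s" for e b s
    using N_guards[OF N(2) wf(2)] that by (force simp: bval_enab)
  have "loop gcs0 \<boxdot> loop (gcs0 @ gcs1) = loop (gcs0 @ gcs1)"
    using guard1 ok N_guards[OF N(1) wf(1)] by (intro loop_split) auto
  then have "C (set_pc pc (lab c)) \<boxdot> loop (gcs0 @ gcs1) =
      C (add_pc pc c) \<boxdot> (C (set_pc pc (lab d)) \<boxdot> loop (gcs0 @ gcs1))"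
    by (metis c mul_assoc)
  also have "C (set_pc pc (lab d)) \<boxdot> loop (gcs0 @ gcs1) = C (set_pc pc (lab d)) \<boxdot> loop gcs1"
    using guard0 ok by (intro N_loop_restrict[OF N(2) wf(2)]) auto
  finally show ?thesis
    by (simp add: d mul_assoc)
qed

text \<open>Serves \<open>If\<close> and \<open>Do\<close> alike: \<open>k\<close> is the common
  exit label of the branches, and \<open>m\<close> holds extra branches, the entries for
  \<open>If\<close> and none for \<open>Do\<close>. Distinct labels keep the other components
  disabled.\<close>

lemma N_branch_restrict:
  assumes N: "list_all2 (\<lambda>gc g. N pc (snd gc) k g) gcs gss"
    and wf: "\<forall>(e, c)\<in>set gcs. wf_com F P c"
    and dist: "distinct (concat (map (\<lambda>(e, c). lab_list c) gcs))"
    and k: "\<And>e c. (e, c) \<in> set gcs \<Longrightarrow> k \<notin> labs c"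
    and i: "i < length gcs" "gcs ! i = (e, c)"
    and m: "\<And>e' d s. (e', d) \<in> set m \<Longrightarrow> bval F P e' s \<Longrightarrow> s pc \<notin> insert k (labs c)"
  shows "C (set_pc pc (lab c)) \<boxdot> loop (m @ concat gss) = C (set_pc pc (lab c)) \<boxdot> loop (gss ! i)"
proof (rule N_loop_restrict)
  have len: "length gss = length gcs"
    using N by (simp add: list_all2_lengthD)
  show "N pc c k (gss ! i)"
    using N i by (auto simp: list_all2_conv_all_nth)
  show "wf_com F P c"
    using wf i nth_mem by fastforce
  show "set (gss ! i) \<subseteq> set (m @ concat gss)"
    using i len by (auto intro!: bexI[of _ "gss ! i"])
  show "s pc \<notin> insert k (labs c)"
    if ed: "(e', d) \<in> set (m @ concat gss)" "(e', d) \<notin> set (gss ! i)" "bval F P e' s" for e' d s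
  proof (cases "(e', d) \<in> set m")
    case True
    then show ?thesis
      using m ed(3) by blast
  next
    case False
    with ed(1) have "(e', d) \<in> set (concat gss)"
      by auto
    from N_concat_guardE[OF N wf this ed(3)] obtain j where
      j: "j < length gcs" "(e', d) \<in> set (gss ! j)" "s pc \<in> labs (snd (gcs ! j))"
      by blast
    with ed(2) have "i \<noteq> j"
      by auto
    then have "labs c \<inter> labs (snd (gcs ! j)) = {}"
      using distinct_branch_labels[OF dist i(1) j(1)] i(2) by simp
    moreover have "k \<notin> labs (snd (gcs ! j))"
      using k[of "fst (gcs ! j)" "snd (gcs ! j)"] j(1) by simp
    ultimately show ?thesis
      using j(3) by auto
  qed
qed

text \<open>At \<open>n\<close> only entries can fire. After one of them the remaining loop is that
  of the selected component, to which \<open>IH\<close> applies.\<close>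

lemma normal_form_if:
  assumes N: "list_all2 (\<lambda>gc g. N pc (snd gc) f g) gcs gss"
    and wf: "wf_com F P (If n gcs)"
    and ok: "okf (If n gcs) f"
    and IH: "\<And>i. i < length gcs \<Longrightarrow> C (set_pc pc (lab (snd (gcs ! i)))) \<boxdot> loop (gss ! i) =
      C (add_pc pc (snd (gcs ! i))) \<boxdot> C (set_pc pc f)"
  shows "C (set_pc pc n) \<boxdot> loop (entries pc n gcs @ concat gss) =
    C (add_pc pc (If n gcs)) \<boxdot> C (set_pc pc f)"
proof -
  let ?S = "\<lambda>k. C (set_pc pc k)"
  let ?n = "test_pc pc n"
  define t where "t = entries pc n gcs @ concat gss"
  define k where "k = map (\<lambda>(e, c). (e, add_pc pc c)) gcs"
  have wfs: "\<forall>(e, c)\<in>set gcs. wf_com F P c"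
    using wf by simp
  have labs: "n \<notin> labs c" "f \<notin> labs c" if "(e, c) \<in> set gcs" for e c
    using ok that by (auto simp: okf_def labs_def)
  have branch: "?S (lab c) \<boxdot> loop t = C (add_pc pc c) \<boxdot> ?S f" if ec: "(e, c) \<in> set gcs" for e c
  proof -
    obtain i where i: "i < length gcs" "gcs ! i = (e, c)"
      using ec by (auto simp: in_set_conv_nth)
    have "?S (lab c) \<boxdot> loop t = ?S (lab c) \<boxdot> loop (gss ! i)"
      unfolding t_def using ok labs ec
      by (intro N_branch_restrict[OF N wfs _ _ i]) (auto simp: okf_def labs_simps entries_def)
    then show ?thesis
      using IH[OF i(1)] i(2) by simp
  qed
  have step: "?S n \<boxdot> B (And ?n e) \<boxdot> ?S (lab c) \<boxdot> loop t = ?S n \<boxdot> B e \<boxdot> C (add_pc pc c) \<boxdot> ?S f"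
    if "(e, c) \<in> set gcs" for e c
    using branch[OF that] by (simp add: B_And mul_assoc)
  have "?S n \<boxdot> loop t = ?S n \<boxdot> G t \<boxdot> loop t"
    using wf by (intro set_pc_loop_step) (simp add: t_def bval_enab_append bval_enab_entries)
  moreover have "?S n \<boxdot> G t \<boxdot> loop t \<preceq> ?S n \<boxdot> G k \<boxdot> ?S f"
    unfolding mul_G_mul_le_iff
  proof clarify
    fix e' d assume ed: "(e', d) \<in> set t"
    show "?S n \<boxdot> B e' \<boxdot> C d \<boxdot> loop t \<preceq> ?S n \<boxdot> G k \<boxdot> ?S f"
    proof (cases "(e', d) \<in> set (entries pc n gcs)")
      case True
      then obtain e c where ec: "(e, c) \<in> set gcs" "e' = And ?n e" "d = set_pc pc (lab c)"
        by (auto simp: entries_def)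
      have "B e \<boxdot> C (add_pc pc c) \<preceq> G k"
        using ec(1) by (intro branch_le_G) (force simp: k_def)
      then have "?S n \<boxdot> (B e \<boxdot> C (add_pc pc c)) \<boxdot> ?S f \<preceq> ?S n \<boxdot> G k \<boxdot> ?S f"
        by (intro mul_mono le_refl)
      then show ?thesis
        by (simp add: ec(2,3) step[OF ec(1)]) (simp add: mul_assoc)
    next
      case False
      with ed have ed': "(e', d) \<in> set (concat gss)"
        by (auto simp: t_def)
      \<comment> \<open>An enabled component branch would make \<open>n\<close> a label of a
        subcommand, against the distinctness of labels.\<close>
      have "?S n \<boxdot> B e' = zero"
      proof (rule set_pc_disjoint, rule notI)
        fix s assume "bval F P e' (s(pc := n))"
        from N_concat_guardE[OF N wfs ed' this] obtain j where
          j: "j < length gcs" "n \<in> labs (snd (gcs ! j))"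
          by auto
        then show False
          using labs(1)[of "fst (gcs ! j)" "snd (gcs ! j)"] by simp
      qed
      then show ?thesis by simp
    qed
  qed
  moreover have "?S n \<boxdot> G k \<boxdot> ?S f \<preceq> ?S n \<boxdot> G t \<boxdot> loop t"
    unfolding mul_G_mul_le_iff
  proof clarify
    fix e d assume "(e, d) \<in> set k"
    then obtain c where ec: "(e, c) \<in> set gcs" "d = add_pc pc c"
      by (auto simp: k_def)
    then have "(And ?n e, set_pc pc (lab c)) \<in> set t"
      by (force simp: t_def entries_def)
    then have "?S n \<boxdot> (B (And ?n e) \<boxdot> ?S (lab c)) \<boxdot> loop t \<preceq> ?S n \<boxdot> G t \<boxdot> loop t"
      by (intro mul_mono branch_le_G le_refl)
    then show "?S n \<boxdot> B e \<boxdot> C d \<boxdot> ?S f \<preceq> ?S n \<boxdot> G t \<boxdot> loop t"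
      using step[OF ec(1)] by (simp add: ec(2) mul_assoc)
  qed
  ultimately have "?S n \<boxdot> loop t = ?S n \<boxdot> G k \<boxdot> ?S f"
    using le_antisym by fastforce
  then show ?thesis
    by (simp add: C_simps t_def k_def)
qed

text \<open>The branches split into \<open>m\<close>, active only at \<open>n\<close>, and
  \<open>h\<close>, active only inside the bodies; one round of the source loop is one entry from
  \<open>m\<close> followed by \<open>loop h\<close>.\<close>

lemma normal_form_do:
  assumes N: "list_all2 (\<lambda>gc g. N pc (snd gc) n g) gcs gss"
    and wf: "wf_com F P (Do n gcs)"
    and ok: "okf (Do n gcs) f"
    and IH: "\<And>i. i < length gcs \<Longrightarrow> C (set_pc pc (lab (snd (gcs ! i)))) \<boxdot> loop (gss ! i) =
      C (add_pc pc (snd (gcs ! i))) \<boxdot> C (set_pc pc n)"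
  shows "C (set_pc pc n) \<boxdot>
      loop (entries pc n gcs @ [(And (test_pc pc n) (Not (enab gcs)), set_pc pc f)] @ concat gss) =
    C (add_pc pc (Do n gcs)) \<boxdot> C (set_pc pc f)"
proof -
  let ?S = "\<lambda>k. C (set_pc pc k)"
  let ?n = "test_pc pc n"
  define m where "m = entries pc n gcs @ [(And ?n (Not (enab gcs)), set_pc pc f)]"
  define h where "h = concat gss"
  define t where "t = m @ h"
  define k where "k = map (\<lambda>(e, c). (e, Seq (add_pc pc c) (set_pc pc n))) gcs"
  define X where "X = B (Not (enab gcs)) \<boxdot> ?S f"
  \<comment> \<open>\<open>W\<close> is \<open>loop k\<close> followed by the assignment of
    \<open>f\<close>, the target after \<open>pc\<close> is set to \<open>n\<close>.\<close>
  define W where "W = star (G k) \<boxdot> X"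
  have wfs: "\<forall>(e, c)\<in>set gcs. wf_com F P c"
    using wf by simp
  have labs: "n \<notin> labs c" "f \<notin> labs c" if "(e, c) \<in> set gcs" for e c
    using ok that by (auto simp: okf_def labs_def)
  have nf: "n \<noteq> f"
    using ok by (auto simp: okf_def labs_def)
  have N': "N pc (Do n gcs) f t"
    unfolding t_def m_def h_def using N_Do[OF N] by simp
  have t: "bval F P (enab t) s \<longleftrightarrow> s pc \<in> labs (Do n gcs)" for s
    by (rule N_guards[OF N' wf])
  have h: "\<exists>(e, c)\<in>set gcs. s pc \<in> labs c" if bh: "bval F P (enab h) s" for s
  proof -
    obtain e d where "(e, d) \<in> set (concat gss)" "bval F P e s"
      using bh unfolding bval_enab h_def by blast
    from N_concat_guardE[OF N wfs this] obtain j where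
      "j < length gcs" "s pc \<in> labs (snd (gcs ! j))"
      by blast
    then show ?thesis
      by (intro bexI[of _ "gcs ! j"]) (simp_all add: case_prod_unfold)
  qed
  have h_exit: "bval F P ?n s \<Longrightarrow> \<not> bval F P (enab h) s" for s
    using h[of s] labs by auto
  have m: "bval F P ?n s" if "(e, d) \<in> set m" "bval F P e s" for e d s
    using that by (auto simp: m_def entries_def)
  have branch: "?S (lab c) \<boxdot> loop h = C (add_pc pc c) \<boxdot> ?S n" if ec: "(e, c) \<in> set gcs" for e c
  proof -
    obtain i where i: "i < length gcs" "gcs ! i = (e, c)"
      using ec by (auto simp: in_set_conv_nth)
    have "?S (lab c) \<boxdot> loop ([] @ h) = ?S (lab c) \<boxdot> loop (gss ! i)"
      unfolding h_def using ok labs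
      by (intro N_branch_restrict[OF N wfs _ _ i]) (auto simp: okf_def)
    then show ?thesis
      using IH[OF i(1)] i(2) by simp
  qed
  have Sn_h: "?S n \<boxdot> loop h = ?S n"
    using h_exit by (intro set_pc_loop_exit) auto
  have Sf_h: "?S f \<boxdot> loop h = ?S f"
    using h labs by (intro set_pc_loop_exit) fastforce
  have Sf_t: "?S f \<boxdot> loop t = ?S f"
    using t ok by (intro set_pc_loop_exit) (auto simp: okf_def)
  have split: "loop h \<boxdot> loop t = loop t"
    using m h_exit by (intro loop_split) (auto simp: t_def)
  have "?S n \<boxdot> loop t \<preceq> ?S n \<boxdot> W"
  proof -
    \<comment> \<open>\<open>V\<close> is the behaviour at the loop head: the iteration if control is at \<open>n\<close>, exit otherwise.
      From any control point the body loop \<open>h\<close> runs first until control leaves it.\<close>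
    define V where "V = B ?n \<boxdot> W \<boxplus> B (Not ?n)"
    have Sn_V: "?S n \<boxdot> V = ?S n \<boxdot> W"
      using set_pc_disjoint[of "Not ?n" pc n] by (simp add: V_def mul_add W_def)
    have "?S f \<boxdot> B ?n = zero" "?S f \<boxdot> B (Not ?n) = ?S f"
      using nf by (auto intro: set_pc_disjoint set_pc_absorb)
    then have Sf_V: "?S f \<boxdot> V = ?S f"
      by (simp add: V_def mul_add flip: mul_assoc)
    have W_V: "B ?n \<boxdot> W \<preceq> loop h \<boxdot> V"
    proof -
      have "B (Not (enab h)) \<boxdot> B ?n = B ?n"
        using h_exit by (intro B_mul_absorb(2)) simp
      then have "B ?n \<boxdot> W = B (Not (enab h)) \<boxdot> (B ?n \<boxdot> W)"
        by (simp flip: mul_assoc)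
      also have "\<dots> \<preceq> loop h \<boxdot> V"
        by (intro mul_mono exit_le_loop) (simp add: V_def le_add)
      finally show ?thesis .
    qed
    have "loop t \<preceq> loop h \<boxdot> V"
      unfolding loop_def[of t]
    proof (rule star_induct_left)
      \<comment> \<open>When \<open>t\<close> stops, control is neither at \<open>n\<close> nor
        inside a body, so \<open>loop h\<close> stops as well and the second summand of
        \<open>V\<close> applies.\<close>
      have "B (Not (enab t)) \<preceq> B (And (Not (enab h)) (Not ?n))"
        using h by (intro B_mono) (fastforce simp: t labs_simps)
      also have "\<dots> \<preceq> loop h \<boxdot> V"
        unfolding B_And by (intro mul_mono exit_le_loop) (simp add: V_def le_add)
      finally show "B (Not (enab t)) \<preceq> loop h \<boxdot> V" .
      show "G t \<boxdot> (loop h \<boxdot> V) \<preceq> loop h \<boxdot> V"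
        unfolding G_mul_le_iff
      proof clarify
        fix e' d assume "(e', d) \<in> set t"
        then consider "(e', d) \<in> set h"
          | e c where "(e, c) \<in> set gcs" "e' = And ?n e" "d = set_pc pc (lab c)"
          | "e' = And ?n (Not (enab gcs))" "d = set_pc pc f"
          by (auto simp: t_def m_def entries_def)
        then show "B e' \<boxdot> C d \<boxdot> (loop h \<boxdot> V) \<preceq> loop h \<boxdot> V"
        proof cases
          case 1
          then have "B e' \<boxdot> C d \<boxdot> loop h \<boxdot> V \<preceq> loop h \<boxdot> V"
            by (intro mul_mono branch_mul_loop_le le_refl)
          then show ?thesis
            by (simp add: mul_assoc)
        next
          case (2 e c)
          have "B e' \<boxdot> C d \<boxdot> (loop h \<boxdot> V) = B ?n \<boxdot> B e \<boxdot> (?S (lab c) \<boxdot> loop h \<boxdot> V)"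
            by (simp add: 2(2,3) B_And mul_assoc)
          also have "\<dots> = B ?n \<boxdot> (B e \<boxdot> C (Seq (add_pc pc c) (set_pc pc n)) \<boxdot> W)"
            by (simp add: branch[OF 2(1)] C_simps mul_assoc Sn_V)
          also have "\<dots> \<preceq> B ?n \<boxdot> (G k \<boxdot> W)"
            using 2(1) by (intro mul_mono branch_le_G le_refl) (force simp: k_def)
          also have "\<dots> \<preceq> B ?n \<boxdot> W"
            unfolding W_def mul_assoc[of "G k", symmetric] by (intro mul_mono mul_star_le le_refl)
          also note W_V
          finally show ?thesis .
        next
          case 3
          have "B e' \<boxdot> C d \<boxdot> (loop h \<boxdot> V) = B ?n \<boxdot> B (Not (enab gcs)) \<boxdot> (?S f \<boxdot> loop h \<boxdot> V)"
            by (simp add: 3 B_And mul_assoc)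
          also have "\<dots> = B ?n \<boxdot> (one \<boxdot> X)"
            by (simp add: Sf_h Sf_V X_def mul_assoc)
          also have "\<dots> \<preceq> B ?n \<boxdot> W"
            unfolding W_def by (intro mul_mono one_le_star le_refl)
          also note W_V
          finally show ?thesis .
        qed
      qed
    qed
    then have "?S n \<boxdot> loop t \<preceq> ?S n \<boxdot> (loop h \<boxdot> V)"
      by (intro mul_mono le_refl)
    also have "\<dots> = ?S n \<boxdot> W"
      by (simp add: Sn_h Sn_V flip: mul_assoc)
    finally show ?thesis .
  qed
  moreover have "?S n \<boxdot> W \<preceq> ?S n \<boxdot> loop t"
  proof -
    \<comment> \<open>The entries of \<open>t\<close> test \<open>pc = n\<close>, whereas the guards
      in \<open>k\<close> do not. Since every body in \<open>k\<close> ends by setting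
      \<open>pc\<close> to \<open>n\<close>, this test can be inserted before each round.\<close>
    define Q where "Q = B ?n \<boxdot> G k"
    have k: "G k \<preceq> G k \<boxdot> B ?n"
      unfolding G_le_iff
    proof clarify
      fix e d assume ed: "(e, d) \<in> set k"
      then have "B e \<boxdot> C d = B e \<boxdot> C d \<boxdot> B ?n"
        by (auto simp: k_def C_simps mul_assoc)
      also have "\<dots> \<preceq> G k \<boxdot> B ?n"
        by (intro mul_mono branch_le_G ed le_refl)
      finally show "B e \<boxdot> C d \<preceq> G k \<boxdot> B ?n" .
    qed
    have "?S n \<boxdot> star (G k) \<preceq> ?S n \<boxdot> star Q \<boxdot> B ?n"
    proof (rule star_induct_right)
      have "?S n = ?S n \<boxdot> one \<boxdot> B ?n"
        by simp
      also have "\<dots> \<preceq> ?S n \<boxdot> star Q \<boxdot> B ?n"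
        by (intro mul_mono one_le_star le_refl)
      finally show "?S n \<preceq> ?S n \<boxdot> star Q \<boxdot> B ?n" .
      have "?S n \<boxdot> star Q \<boxdot> B ?n \<boxdot> G k \<preceq> ?S n \<boxdot> star Q \<boxdot> B ?n \<boxdot> (G k \<boxdot> B ?n)"
        by (intro mul_mono k le_refl)
      also have "\<dots> = ?S n \<boxdot> (star Q \<boxdot> Q) \<boxdot> B ?n"
        by (simp add: Q_def mul_assoc)
      also have "\<dots> \<preceq> ?S n \<boxdot> star Q \<boxdot> B ?n"
        by (intro mul_mono mul_star_le le_refl)
      finally show "?S n \<boxdot> star Q \<boxdot> B ?n \<boxdot> G k \<preceq> ?S n \<boxdot> star Q \<boxdot> B ?n" .
    qed
    then have "?S n \<boxdot> star (G k) \<boxdot> X \<preceq> ?S n \<boxdot> star Q \<boxdot> B ?n \<boxdot> X"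
      by (rule mul_mono[OF _ le_refl])
    also have "\<dots> = ?S n \<boxdot> (star Q \<boxdot> (B ?n \<boxdot> X))"
      by (simp add: mul_assoc)
    also have "\<dots> \<preceq> ?S n \<boxdot> loop t"
    \<comment> \<open>The base case is the exit branch of \<open>t\<close>. A round of
      \<open>Q\<close> is an entry followed by \<open>loop h\<close>, which \<open>split\<close>
      absorbs into \<open>loop t\<close>.\<close>
    proof (intro mul_mono le_refl star_induct_left)
      have "B (And ?n (Not (enab gcs))) \<boxdot> ?S f \<boxdot> loop t \<preceq> loop t"
        by (rule branch_mul_loop_le) (simp add: t_def m_def)
      then show "B ?n \<boxdot> X \<preceq> loop t"
        by (simp add: X_def B_And mul_assoc Sf_t)
      show "Q \<boxdot> loop t \<preceq> loop t"
        unfolding Q_def mul_G_mul_le_iff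
      proof clarify
        fix e d assume "(e, d) \<in> set k"
        then obtain c where ec: "(e, c) \<in> set gcs" "d = Seq (add_pc pc c) (set_pc pc n)"
          by (auto simp: k_def)
        have "B ?n \<boxdot> B e \<boxdot> C d \<boxdot> loop t = B ?n \<boxdot> B e \<boxdot> (C (add_pc pc c) \<boxdot> ?S n) \<boxdot> loop t"
          by (simp add: ec(2) C_simps)
        also have "\<dots> = B ?n \<boxdot> B e \<boxdot> (?S (lab c) \<boxdot> (loop h \<boxdot> loop t))"
          unfolding branch[OF ec(1), symmetric] by (simp add: mul_assoc)
        also have "\<dots> = B (And ?n e) \<boxdot> ?S (lab c) \<boxdot> loop t"
          by (simp add: split B_And mul_assoc)
        also have "\<dots> \<preceq> loop t"
          using ec(1) by (intro branch_mul_loop_le) (force simp: t_def m_def entries_def)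
        finally show "B ?n \<boxdot> B e \<boxdot> C d \<boxdot> loop t \<preceq> loop t" .
      qed
    qed
    finally show ?thesis
      by (simp add: W_def mul_assoc)
  qed
  ultimately have "?S n \<boxdot> loop t = ?S n \<boxdot> W"
    using le_antisym by fastforce
  moreover have "B (Not (enab k)) = B (Not (enab gcs))"
    by (rule B_cong) (force simp: bval_enab k_def)
  then have "loop k \<boxdot> ?S f = W"
    by (simp add: W_def X_def loop_def mul_assoc)
  ultimately show ?thesis
    by (simp add: C_simps t_def m_def h_def k_def mul_assoc)
qed

text \<open>The exit label varies in the induction, so \<open>okf\<close> must be re-established for
  it: \<open>lab d\<close> for the first half of a \<open>Seq\<close>, the loop label for a
  \<open>Do\<close> body.\<close>

lemma normal_form:
  assumes "N pc c f gcs" "wf_com F P c" "okf c f"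
  shows "C (set_pc pc (lab c)) \<boxdot> loop gcs = C (add_pc pc c) \<boxdot> C (set_pc pc f)"
  using assms
proof (induction rule: N.induct)
  case (N_Skip n f)
  then show ?case
    using normal_form_atomic[of "set_pc pc f" one pc f n] by (simp add: C_simps okf_def labs_simps)
next
  case (N_Assign n x e f)
  \<comment> \<open>The translation erases labels, so the label \<open>0\<close> used in the normal
    form is harmless.\<close>
  have "C (Assign 0 x e) = C (Assign n x e)"
    by (simp add: C_def)
  with N_Assign show ?case
    using normal_form_atomic[of "Seq (Assign 0 x e) (set_pc pc f)" "C (Assign 0 x e)" pc f n]
    by (simp add: C_simps okf_def labs_simps mul_assoc)
next
  case (N_Havoc n x f)
  have "C (Havoc 0 x) = C (Havoc n x)"
    by (simp add: C_def)
  with N_Havoc show ?case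
    using normal_form_atomic[of "Seq (Havoc 0 x) (set_pc pc f)" "C (Havoc 0 x)" pc f n]
    by (simp add: C_simps okf_def labs_simps mul_assoc)
next
  case (N_Seq c d gcs0 f gcs1)
  have ok: "labs c \<inter> labs d = {}" "f \<notin> labs c" "okf c (lab d)" "okf d f"
    using N_Seq.prems(2) lab_in_labs[of d] by (auto simp: okf_def labs_def)
  show ?case
    using normal_form_seq[OF N_Seq.hyps _ _ ok(1,2)] N_Seq.IH N_Seq.prems(1) ok(3,4)
    by (simp add: C_simps)
next
  case (N_If f gcs gss n)
  have ok: "okf c f" "wf_com F P c" if "(e, c) \<in> set gcs" for e c
    using N_If.prems that by (auto simp: okf_def labs_def distinct_concat_iff)
  have "C (set_pc pc (lab (snd (gcs ! i)))) \<boxdot> loop (gss ! i) =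
      C (add_pc pc (snd (gcs ! i))) \<boxdot> C (set_pc pc f)" if "i < length gcs" for i
    using N_If.IH that ok[of "fst (gcs ! i)" "snd (gcs ! i)"] by (simp add: list_all2_conv_all_nth)
  moreover have "list_all2 (\<lambda>gc g. N pc (snd gc) f g) gcs gss"
    using N_If.IH by (rule list_all2_mono) simp
  ultimately show ?case
    unfolding lab.simps using N_If.prems by (intro normal_form_if)
next
  case (N_Do n gcs gss f)
  have ok: "okf c n" "wf_com F P c" if "(e, c) \<in> set gcs" for e c
    using N_Do.prems that by (auto simp: okf_def labs_def distinct_concat_iff)
  have "C (set_pc pc (lab (snd (gcs ! i)))) \<boxdot> loop (gss ! i) =
      C (add_pc pc (snd (gcs ! i))) \<boxdot> C (set_pc pc n)" if "i < length gcs" for i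
    using N_Do.IH that ok[of "fst (gcs ! i)" "snd (gcs ! i)"] by (simp add: list_all2_conv_all_nth)
  moreover have "list_all2 (\<lambda>gc g. N pc (snd gc) n g) gcs gss"
    using N_Do.IH by (rule list_all2_mono) simp
  ultimately show ?case
    unfolding lab.simps using N_Do.prems by (intro normal_form_do)
qed

end

theorem theorem5p12:
  fixes F :: "'f fun_interp" and P :: "'p pred_interp"
    and c :: "('f, 'p) com" and f n :: int and pc :: vname and gcs :: "('f, 'p) gcs"
  assumes "wf_com F P c"
    and "okf c f"
    and "pc \<notin> cvars c"
    and "N pc c f gcs"
    and "n = lab c"
  shows "com_equiv F P (Seq (set_pc pc n) (Do 0 gcs)) (Seq (add_pc pc c) (set_pc pc f))"
proof -
  interpret gcl_theory F P .
  \<comment> \<open>Equality of representatives is provable equality by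
    \<open>rep_eq_iff\<close>.\<close>
  have "C (Seq (set_pc pc n) (Do 0 gcs)) = C (Seq (add_pc pc c) (set_pc pc f))"
    using normal_form assms(1,2,4,5) by (simp add: C_simps)
  then show ?thesis
    by (simp add: com_equiv_def C_def rep_eq_iff)
qed

end
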